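(* Let $m\geq 0$ and $r\geq 3$ be integers. For every bad choice $\mathcal{B}$ on $[m]$, $$\operatorname{forb}(m,r,\mathcal{B})-(r-1)^m-m(r-1)^{m-1}\leq H\left(m,\tfrac{r-1}{r-2}\right)\cdot(r-2)^{m-2}.$$
   Context: For a finite set $T$ with $|T|=3$ and $x\in T$, let $e_x\in\{0,1\}^T$ have a 1 in position $x$ and 0 elsewhere, and $\bar e_x=\mathbf 1-e_x$. A choice on $[m]$ is a family $\mathcal{B}=(B_T)_{T\in\binom{[m]}{3}}$ where each $B_T\subseteq\{0,1\}^T$ contains exactly one vector from each of the three pairs $\{e_x,\bar e_x\}$, $x\in T$. $B_T$ is of type $I$ if $B_T=\{e_x:x\in T\}$ and of type $I^c$ if $B_T=\{\bar e_x:x\in T\}$. The choice is bad if some $B_T$ is of type $I$ or $I^c$, and good otherwise. $\operatorname{forb}(m,r,\mathcal{B})$ is the maximum number of columns of a simple (pairwise distinct columns) $m$-rowed matrix with entries in $\{0,\dots,r-1\}$ such that for every column $c$ and every $T\in\binom{[m]}{3}$, $c|_T\notin B_T$. A triangular choice multigraph (TCM) $\mathcal{G}$ on $[m]$ is obtained by choosing, for every 3-element subset $\{u,v,w\}$, exactly one of the pairs $uv,uw,vw$ and adding one copy of it as an edge; $m^{\mathcal{G}}_{xy}$ is the multiplicity of $xy$; $w(\mathcal{G},\alpha)=\sum_{xy\in\binom{[m]}{2}}\alpha^{m^{\mathcal{G}}_{xy}}$ and $H(m,\alpha)$ is the maximum of $w(\mathcal{G},\alpha)$ over all TCMs on $[m]$.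 *)

theory Defs
  imports Complex_Main "HOL-Library.Ramsey" "HOL-Library.FuncSet" "HOL-Library.Multiset"
begin

text \<open>
  \<open>nsets A k\<close>, written \<open>[A]\<^bsup>k\<^esup>\<close>, is the set of all \<open>k\<close>-element subsets of \<open>A\<close>.
  The elements of \<open>{0,1}\<^sup>T\<close> are the extensional functions \<open>T \<rightarrow>\<^sub>E {0, 1}\<close> with values in \<open>nat\<close>,
  so that they can be compared with restrictions of columns with entries in \<open>{0..<r}\<close>.
\<close>

definition unit_vec_on :: "nat set \<Rightarrow> nat \<Rightarrow> (nat \<Rightarrow> nat)" where
  "unit_vec_on T x = (\<lambda>y\<in>T. if y = x then 1 else 0)"

definition counit_vec_on :: "nat set \<Rightarrow> nat \<Rightarrow> (nat \<Rightarrow> nat)" where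
  "counit_vec_on T x = (\<lambda>y\<in>T. 1 - unit_vec_on T x y)"

text \<open>
  Only the values of a family \<open>B\<close> at the 3-element subsets of \<open>{1..m}\<close> matter.
  As \<open>B T\<close> is an arbitrary subset of \<open>{0,1}\<^sup>T\<close>, it may or may not contain the two constant vectors,
  which belong to none of the three pairs.
\<close>

definition is_choice :: "nat \<Rightarrow> (nat set \<Rightarrow> (nat \<Rightarrow> nat) set) \<Rightarrow> bool" where
  "is_choice m B \<longleftrightarrow>
     (\<forall>T \<in> [{1..m}]\<^bsup>3\<^esup>. B T \<subseteq> (T \<rightarrow>\<^sub>E {0, 1}) \<and>
        (\<forall>x\<in>T. \<exists>!v. v \<in> {unit_vec_on T x, counit_vec_on T x} \<and> v \<in> B T))"

definition type_I :: "(nat set \<Rightarrow> (nat \<Rightarrow> nat) set) \<Rightarrow> nat set \<Rightarrow> bool" where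
  "type_I B T \<longleftrightarrow> B T = unit_vec_on T ` T"

definition type_Ic :: "(nat set \<Rightarrow> (nat \<Rightarrow> nat) set) \<Rightarrow> nat set \<Rightarrow> bool" where
  "type_Ic B T \<longleftrightarrow> B T = counit_vec_on T ` T"

definition bad_choice :: "nat \<Rightarrow> (nat set \<Rightarrow> (nat \<Rightarrow> nat) set) \<Rightarrow> bool" where
  "bad_choice m B \<longleftrightarrow> is_choice m B \<and> (\<exists>T \<in> [{1..m}]\<^bsup>3\<^esup>. type_I B T \<or> type_Ic B T)"

text \<open>
  A matrix with rows \<open>{1..m}\<close> and columns \<open>{1..n}\<close> is a function \<open>A\<close> with \<open>A j i\<close> the entry in
  column \<open>j\<close> and row \<open>i\<close>; thus \<open>A j\<close> is its \<open>j\<close>-th column.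
\<close>

definition simple_matrix :: "nat \<Rightarrow> nat \<Rightarrow> nat \<Rightarrow> (nat \<Rightarrow> nat \<Rightarrow> nat) \<Rightarrow> bool" where
  "simple_matrix m n r A \<longleftrightarrow>
     (\<forall>j\<in>{1..n}. A j \<in> {1..m} \<rightarrow>\<^sub>E {0..<r}) \<and> inj_on A {1..n}"

definition avoids :: "nat \<Rightarrow> nat \<Rightarrow> (nat set \<Rightarrow> (nat \<Rightarrow> nat) set) \<Rightarrow> (nat \<Rightarrow> nat \<Rightarrow> nat) \<Rightarrow> bool" where
  "avoids m n B A \<longleftrightarrow> (\<forall>j\<in>{1..n}. \<forall>T \<in> [{1..m}]\<^bsup>3\<^esup>. restrict (A j) T \<notin> B T)"

definition forb :: "nat \<Rightarrow> nat \<Rightarrow> (nat set \<Rightarrow> (nat \<Rightarrow> nat) set) \<Rightarrow> nat" where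
  "forb m r B = Max {n. \<exists>A. simple_matrix m n r A \<and> avoids m n B A}"

text \<open>
  A triangular choice multigraph is the multiset of its edges, an edge being a 2-element set of
  vertices; the choice function \<open>g\<close> picks one edge from each triangle.
\<close>

definition is_tcm :: "nat \<Rightarrow> nat set multiset \<Rightarrow> bool" where
  "is_tcm m G \<longleftrightarrow>
     (\<exists>g. (\<forall>T \<in> [{1..m}]\<^bsup>3\<^esup>. g T \<in> [T]\<^bsup>2\<^esup>) \<and> G = image_mset g (mset_set ([{1..m}]\<^bsup>3\<^esup>)))"

definition tcm_weight :: "nat \<Rightarrow> nat set multiset \<Rightarrow> real \<Rightarrow> real" where
  "tcm_weight m G \<alpha> = (\<Sum>e \<in> [{1..m}]\<^bsup>2\<^esup>. \<alpha> ^ count G e)"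

definition max_tcm_weight :: "nat \<Rightarrow> real \<Rightarrow> real" where
  "max_tcm_weight m \<alpha> = Max {tcm_weight m G \<alpha> | G. is_tcm m G}"

text \<open>The two maxima are taken over finite nonempty sets.\<close>

lemma finite_forb_set: "finite {n. \<exists>A. simple_matrix m n r A \<and> avoids m n B A}"
proof (rule finite_subset)
  have fin: "finite ({1..m} \<rightarrow>\<^sub>E {0..<r})" by (intro finite_PiE) auto
  show "{n. \<exists>A. simple_matrix m n r A \<and> avoids m n B A} \<subseteq> {..card ({1..m} \<rightarrow>\<^sub>E {0..<r})}"
  proof clarsimp
    fix n A assume "simple_matrix m n r A"
    then have "inj_on A {1..n}" "A ` {1..n} \<subseteq> ({1..m} \<rightarrow>\<^sub>E {0..<r})"
      unfolding simple_matrix_def by blast+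
    from card_inj_on_le[OF this fin] show "n \<le> card ({Suc 0..m} \<rightarrow>\<^sub>E {0..<r})" by simp
  qed
qed simp

lemma forb_set_nonempty: "0 \<in> {n. \<exists>A. simple_matrix m n r A \<and> avoids m n B A}"
  by (simp add: simple_matrix_def avoids_def)

lemma finite_tcm_weights: "finite {tcm_weight m G \<alpha> | G. is_tcm m G}"
proof -
  let ?P = "[{1..m}]\<^bsup>3\<^esup>"
  have fin: "finite ?P" by (simp add: finite_imp_finite_nsets)
  have "G \<in> (\<lambda>g. image_mset g (mset_set ?P)) ` (\<Pi>\<^sub>E T\<in>?P. [T]\<^bsup>2\<^esup>)" if G: "is_tcm m G" for G
  proof -
    from G obtain g where g: "\<forall>T\<in>?P. g T \<in> [T]\<^bsup>2\<^esup>" "G = image_mset g (mset_set ?P)"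
      unfolding is_tcm_def by blast
    have "G = image_mset (restrict g ?P) (mset_set ?P)"
      unfolding g(2) using fin by (intro image_mset_cong) auto
    with g(1) show ?thesis by (intro image_eqI[of _ _ "restrict g ?P"]) auto
  qed
  then have "{G. is_tcm m G} \<subseteq> (\<lambda>g. image_mset g (mset_set ?P)) ` (\<Pi>\<^sub>E T\<in>?P. [T]\<^bsup>2\<^esup>)" by blast
  moreover have "finite (\<Pi>\<^sub>E T\<in>?P. [T]\<^bsup>2\<^esup>)"
    using fin by (intro finite_PiE) (auto intro!: finite_imp_finite_nsets simp: nsets_def)
  ultimately have "finite {G. is_tcm m G}" by (meson finite_imageI finite_subset)
  then show ?thesis by simp
qed

lemma tcm_weights_nonempty: "{tcm_weight m G \<alpha> | G. is_tcm m G} \<noteq> {}"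
proof -
  have "\<exists>e. e \<in> [T]\<^bsup>2\<^esup>" if "T \<in> [{1..m}]\<^bsup>3\<^esup>" for T
  proof -
    from that have "2 \<le> card T" by (auto simp: nsets_def)
    then obtain e where "e \<subseteq> T" "card e = 2" "finite e" by (rule obtain_subset_with_card_n)
    then show ?thesis by (auto simp: nsets_def)
  qed
  then have "\<exists>g. \<forall>T \<in> [{1..m}]\<^bsup>3\<^esup>. g T \<in> [T]\<^bsup>2\<^esup>" by metis
  then show ?thesis unfolding is_tcm_def by blast
qed

end

theory Submission
  imports Defs
begin

text \<open>
  Let \<open>F S\<close> be the family of sets \<open>A \<subseteq> S\<close> whose indicator vectors are allowed on the triples inside \<open>S\<close>.
  Sorting columns by the set \<open>S\<close> of rows with entries below 2 bounds \<open>forb\<close> by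
  \<open>\<Sum>\<^sub>S |F S| (r - 2)\<^bsup>m - |S|\<^esup>\<close>. Compress every \<open>F S\<close> to a downward closed family of the same size,
  eliminating the rows in one fixed order. The result is monotone in \<open>F S\<close> and commutes with traces up
  to inclusion, so a pair \<open>e \<subseteq> T \<subseteq> S\<close> in the compression of \<open>F S\<close> also lies in that of \<open>F T\<close>.
  A triple \<open>T\<close> has \<open>|F T| \<le> 5\<close>, so its compression contains at most one pair, and not \<open>T\<close> itself.
  Let the TCM choose this pair. Then \<open>|F S| \<le> 1 + |S| + p(S)\<close>, where \<open>p(S)\<close> counts the
  pairs \<open>e \<subseteq> S\<close> chosen by all triples \<open>T\<close> with \<open>e \<subseteq> T \<subseteq> S\<close>, and summation over \<open>S\<close> gives the three
  terms \<open>(r - 1)\<^bsup>m\<^esup>\<close>, \<open>m (r - 1)\<^bsup>m - 1\<^esup>\<close> and \<open>w(\<G>, (r - 1)/(r - 2)) (r - 2)\<^bsup>m - 2\<^esup>\<close>.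
\<close>

section \<open>Compression of set families to downward closed ones\<close>

text \<open>
  For \<open>F \<subseteq> Pow {1..n}\<close> these are the sets order-shattered by \<open>F\<close> in the sense of Anstee, Ronyai and Sali,
  up to reversing the order of the rows.
\<close>

fun compress :: "nat \<Rightarrow> nat set set \<Rightarrow> nat set set" where
  "compress 0 F = F"
| "compress (Suc n) F = compress n ((\<lambda>A. A - {Suc n}) ` F)
     \<union> insert (Suc n) ` compress n {A. Suc n \<notin> A \<and> A \<in> F \<and> insert (Suc n) A \<in> F}"

lemma compress_mono: "F \<subseteq> G \<Longrightarrow> compress n F \<subseteq> compress n G"
proof (induction n arbitrary: F G)
  case (Suc n)
  have "compress n ((\<lambda>A. A - {Suc n}) ` F) \<subseteq> compress n ((\<lambda>A. A - {Suc n}) ` G)"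
    using Suc.prems by (intro Suc.IH) blast
  moreover have "compress n {A. Suc n \<notin> A \<and> A \<in> F \<and> insert (Suc n) A \<in> F}
      \<subseteq> compress n {A. Suc n \<notin> A \<and> A \<in> G \<and> insert (Suc n) A \<in> G}"
    using Suc.prems by (intro Suc.IH) blast
  ultimately show ?case by (simp, blast)
qed simp

lemma delete_max_subset:
  assumes "F \<subseteq> Pow {1..Suc n}"
  shows "(\<lambda>A. A - {Suc n}) ` F \<subseteq> Pow {1..n}"
    and "{A. Suc n \<notin> A \<and> A \<in> F \<and> insert (Suc n) A \<in> F} \<subseteq> Pow {1..n}"
proof -
  have *: "A - {Suc n} \<subseteq> {1..n}" if "A \<in> F" for A
    using assms that by (fastforce simp: le_Suc_eq)
  from * show "(\<lambda>A. A - {Suc n}) ` F \<subseteq> Pow {1..n}" by blast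
  from * show "{A. Suc n \<notin> A \<and> A \<in> F \<and> insert (Suc n) A \<in> F} \<subseteq> Pow {1..n}"
    by (metis (no_types, lifting) Diff_empty Diff_insert0 PowI mem_Collect_eq subsetI)
qed

lemma compress_empty [simp]: "compress n {} = {}"
  by (induction n) simp_all

text \<open>The ground set \<open>S\<close> is arbitrary, since the compression of
  \<open>F S\<close> has to stay inside \<open>S\<close> although all rows up to \<open>m\<close>
  are eliminated.\<close>

lemma compress_subset: "F \<subseteq> Pow S \<Longrightarrow> compress n F \<subseteq> Pow S"
proof (induction n arbitrary: F)
  case (Suc n)
  define L where "L = {A. Suc n \<notin> A \<and> A \<in> F \<and> insert (Suc n) A \<in> F}"
  have "compress n ((\<lambda>A. A - {Suc n}) ` F) \<subseteq> Pow S" "compress n L \<subseteq> Pow S"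
    using Suc.prems by (auto simp: L_def intro!: Suc.IH)
  \<comment> \<open>If the row lies outside \<open>S\<close>, then \<open>L\<close> and its
    compression are empty, and no set containing that row is added.\<close>
  moreover have "Suc n \<in> S" if "L \<noteq> {}"
    using that Suc.prems by (auto simp: L_def)
  then have "insert (Suc n) ` compress n L \<subseteq> Pow S"
    using \<open>compress n L \<subseteq> Pow S\<close> by (cases "L = {}") auto
  ultimately show ?case by (simp add: L_def)
qed simp

text \<open>Split \<open>F\<close> into \<open>F0\<close>, the sets without the last row, and
  \<open>F1\<close>, those with it. Once the row is deleted from \<open>F1\<close>, \<open>P\<close>
  is the union and \<open>L\<close> the intersection of the two families, so
  \<open>|P| + |L| = |F|\<close>. The two parts of the recursion are disjoint, as only sets of the
  second contain the row.\<close>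

lemma card_compress: "F \<subseteq> Pow {1..n} \<Longrightarrow> card (compress n F) = card F"
proof (induction n arbitrary: F)
  case (Suc n)
  define P L where "P = (\<lambda>A. A - {Suc n}) ` F"
    and "L = {A. Suc n \<notin> A \<and> A \<in> F \<and> insert (Suc n) A \<in> F}"
  note sub = delete_max_subset[OF Suc.prems, folded P_def L_def]
  note subc = compress_subset[OF sub(1), of n] compress_subset[OF sub(2), of n]
  have fin: "finite F" "finite (compress n P)" "finite (compress n L)"
    using Suc.prems subc by (auto intro: finite_subset)
  have notin: "Suc n \<notin> A" if "A \<in> compress n P \<union> compress n L" for A
    using that subc by (metis PowD Suc_n_not_le_n UnE atLeastAtMost_iff subsetD)
  have "card (compress (Suc n) F) = card (compress n P \<union> insert (Suc n) ` compress n L)"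
    by (simp add: P_def L_def)
  also have "\<dots> = card (compress n P) + card (insert (Suc n) ` compress n L)"
    using fin notin by (intro card_Un_disjoint) auto
  also have "card (insert (Suc n) ` compress n L) = card (compress n L)"
    using notin by (intro card_image inj_onI) (metis UnCI insert_ident)
  finally have 1: "card (compress (Suc n) F) = card P + card L"
    using Suc.IH sub by simp
  define F0 F1 where "F0 = {A \<in> F. Suc n \<notin> A}" and "F1 = {A \<in> F. Suc n \<in> A}"
  have fin01: "finite F0" "finite F1" using fin by (simp_all add: F0_def F1_def)
  have inj1: "inj_on (\<lambda>A. A - {Suc n}) F1"
    by (intro inj_onI) (metis (mono_tags, lifting) F1_def insert_Diff mem_Collect_eq)
  have "A \<in> P" if "A \<in> F0" for A
    using that by (auto simp: P_def F0_def intro!: image_eqI[of _ _ A])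
  then have "P = F0 \<union> (\<lambda>A. A - {Suc n}) ` F1"
    unfolding P_def F0_def F1_def by fastforce
  moreover have "A \<in> (\<lambda>A. A - {Suc n}) ` F1" if "A \<in> L" for A
    using that by (auto simp: L_def F1_def intro!: image_eqI[of _ _ "insert (Suc n) A"])
  then have "L = F0 \<inter> (\<lambda>A. A - {Suc n}) ` F1"
    by (auto simp: L_def F0_def F1_def insert_absorb)
  ultimately have "card P + card L = card F0 + card ((\<lambda>A. A - {Suc n}) ` F1)"
    using card_Un_Int[OF fin01(1) finite_imageI[OF fin01(2)]] by simp
  also have "\<dots> = card F0 + card F1" using inj1 by (simp add: card_image)
  also have "\<dots> = card (F0 \<union> F1)"
    using fin01 by (subst card_Un_disjoint) (auto simp: F0_def F1_def)
  also have "F0 \<union> F1 = F" by (auto simp: F0_def F1_def)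
  finally show ?case using 1 by simp
qed simp

text \<open>Deleting the last row from a set of the second part leads into
  \<open>compress n L\<close>, which lies in \<open>compress n P\<close> because
  \<open>L \<subseteq> P\<close>. Subsets that keep the row stay in the second part.\<close>

lemma compress_downward_closed:
  "F \<subseteq> Pow {1..n} \<Longrightarrow> s \<in> compress n F \<Longrightarrow> t \<subseteq> s \<Longrightarrow> t \<in> compress n F"
proof (induction n arbitrary: F s t)
  case (Suc n)
  define P L where "P = (\<lambda>A. A - {Suc n}) ` F"
    and "L = {A. Suc n \<notin> A \<and> A \<in> F \<and> insert (Suc n) A \<in> F}"
  note sub = delete_max_subset[OF Suc.prems(1), folded P_def L_def]
  have eq: "compress (Suc n) F = compress n P \<union> insert (Suc n) ` compress n L"
    by (simp add: P_def L_def)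
  have "L \<subseteq> P" by (auto simp: P_def L_def intro!: image_eqI)
  then have LP: "compress n L \<subseteq> compress n P" by (rule compress_mono)
  from Suc.prems(2) consider "s \<in> compress n P" | u where "u \<in> compress n L" "s = insert (Suc n) u"
    unfolding eq by blast
  then show ?case
  proof cases
    case 1
    then show ?thesis using Suc.IH[OF sub(1)] Suc.prems(3) eq by blast
  next
    case 2
    then have "t - {Suc n} \<in> compress n L" using Suc.IH[OF sub(2)] Suc.prems(3) by blast
    then show ?thesis using LP eq by (cases "Suc n \<in> t") (auto simp: image_iff insert_absorb)
  qed
qed auto

text \<open>Deleting a row commutes with taking traces. If the row belongs to \<open>S\<close>, the
  trace of \<open>L F\<close> lies in \<open>L\<close> of the trace; it may be smaller, as sets that
  differ outside \<open>S\<close> can become partners. Monotonicity bridges the gap.\<close>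

lemma compress_trace:
  "s \<in> compress n F \<Longrightarrow> s \<subseteq> S \<Longrightarrow> s \<in> compress n ((\<lambda>A. A \<inter> S) ` F)"
proof (induction n arbitrary: F s)
  case 0
  then show ?case by (auto simp: Int_absorb2 intro!: image_eqI[of _ _ s])
next
  case (Suc n)
  define P L where "P = (\<lambda>G. (\<lambda>A. A - {Suc n}) ` G)"
    and "L = (\<lambda>G. {A. Suc n \<notin> A \<and> A \<in> G \<and> insert (Suc n) A \<in> G})"
  have eq: "compress (Suc n) G = compress n (P G) \<union> insert (Suc n) ` compress n (L G)" for G
    by (simp add: P_def L_def)
  have P: "P ((\<lambda>A. A \<inter> S) ` F) = (\<lambda>A. A \<inter> S) ` P F"
    by (auto simp: P_def image_image intro!: image_cong)
  from Suc.prems(1) consider "s \<in> compress n (P F)" | u where "u \<in> compress n (L F)" "s = insert (Suc n) u"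
    unfolding eq by blast
  then show ?case
  proof cases
    case 1
    then show ?thesis using Suc.IH Suc.prems(2) eq P by auto
  next
    case 2
    \<comment> \<open>The row belongs to \<open>s\<close> and hence to \<open>S\<close>, so
      inserting it commutes with intersecting with \<open>S\<close>.\<close>
    have "A \<inter> S \<in> L ((\<lambda>A. A \<inter> S) ` F)" if "A \<in> L F" for A
    proof -
      have "insert (Suc n) (A \<inter> S) = insert (Suc n) A \<inter> S" using 2 Suc.prems(2) by blast
      then show ?thesis using that by (auto simp: L_def)
    qed
    then have "(\<lambda>A. A \<inter> S) ` L F \<subseteq> L ((\<lambda>A. A \<inter> S) ` F)" by blast
    then have "compress n ((\<lambda>A. A \<inter> S) ` L F) \<subseteq> compress n (L ((\<lambda>A. A \<inter> S) ` F))"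
      by (rule compress_mono)
    moreover have "u \<in> compress n ((\<lambda>A. A \<inter> S) ` L F)"
      using 2 Suc.prems(2) by (intro Suc.IH) auto
    ultimately show ?thesis unfolding eq 2(2) by blast
  qed
qed

section \<open>Pairs in the compressed families and the choice of the TCM\<close>

text \<open>The triple itself would bring along all eight subsets of \<open>T\<close>. Two distinct
  pairs cover \<open>T\<close> and bring along the empty set and all three singletons, six sets in
  total. Both exceed five.\<close>

lemma downward_closed_triple:
  assumes D: "\<forall>s\<in>D. Pow s \<subseteq> D"
    and fin: "finite D" and five: "card D \<le> 5" and T: "finite T" "card T = 3"
  shows "T \<notin> D" and "e \<in> [T]\<^bsup>2\<^esup> \<Longrightarrow> f \<in> [T]\<^bsup>2\<^esup> \<Longrightarrow> e \<in> D \<Longrightarrow> f \<in> D \<Longrightarrow> e = f"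
proof -
  show "T \<notin> D"
  proof
    assume "T \<in> D"
    then have "card (Pow T) \<le> card D" using D fin by (intro card_mono) blast+
    with five T show False by (simp add: card_Pow)
  qed
next
  assume ef: "e \<in> [T]\<^bsup>2\<^esup>" "f \<in> [T]\<^bsup>2\<^esup>" "e \<in> D" "f \<in> D"
  then have e: "e \<subseteq> T" "finite e" "card e = 2" and f: "f \<subseteq> T" "finite f" "card f = 2"
    by (auto simp: nsets_def)
  show "e = f"
  proof (rule ccontr)
    assume "e \<noteq> f"
    have "\<not> f \<subseteq> e" using e f \<open>e \<noteq> f\<close> by (metis card_subset_eq)
    then have "e \<subset> e \<union> f" by blast
    then have "card e < card (e \<union> f)" using e f by (intro psubset_card_mono) auto
    then have "T = e \<union> f" using e f T by (intro card_seteq[symmetric]) auto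
    then have sing: "{x} \<in> D" if "x \<in> T" for x using that ef D by blast
    have "{} \<in> D" using ef D by blast
    with sing ef have sub: "{e, f, {}} \<union> (\<lambda>x. {x}) ` T \<subseteq> D" by auto
    have "card ({e, f, {}} \<union> (\<lambda>x. {x}) ` T) = card {e, f, {}} + card ((\<lambda>x. {x}) ` T)"
      using e f T by (intro card_Un_disjoint) auto
    also have "card {e, f, {}} = 3" using e f \<open>e \<noteq> f\<close> by (auto simp: card_insert_if)
    also have "card ((\<lambda>x. {x}) ` T) = 3" using T by (simp add: card_image)
    finally show False using card_mono[OF fin sub] five by simp
  qed
qed

text \<open>The last cardinality is \<open>p(S)\<close>, with the triples between \<open>e\<close>
  and \<open>S\<close> written as \<open>insert z e\<close>. Each triple takes the pair in its
  compression, and the members of the compression of \<open>F S\<close> are then counted by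
  size.\<close>

lemma obtain_tcm_choice:
  fixes F :: "nat set \<Rightarrow> nat set set"
  assumes sub: "\<And>S. S \<subseteq> {1..m} \<Longrightarrow> F S \<subseteq> Pow S"
    and trace: "\<And>S T. S \<subseteq> {1..m} \<Longrightarrow> T \<subseteq> S \<Longrightarrow> (\<lambda>A. A \<inter> T) ` F S \<subseteq> F T"
    and five: "\<And>T. T \<in> [{1..m}]\<^bsup>3\<^esup> \<Longrightarrow> card (F T) \<le> 5"
  obtains g where "\<And>T. T \<in> [{1..m}]\<^bsup>3\<^esup> \<Longrightarrow> g T \<in> [T]\<^bsup>2\<^esup>"
    and "\<And>S. S \<subseteq> {1..m} \<Longrightarrow>
      card (F S) \<le> 1 + card S + card {e \<in> [S]\<^bsup>2\<^esup>. \<forall>z\<in>S - e. g (insert z e) = e}"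
proof -
  define D where "D = (\<lambda>S. compress m (F S))"
  have sub': "F S \<subseteq> Pow {1..m}" if "S \<subseteq> {1..m}" for S using sub[OF that] that by blast
  have Dsub: "D S \<subseteq> Pow S" if "S \<subseteq> {1..m}" for S
    unfolding D_def by (intro compress_subset sub that)
  have Dfin: "finite (D S)" if "S \<subseteq> {1..m}" for S
    using Dsub[OF that] that by (meson finite_Pow_iff finite_atLeastAtMost finite_subset)
  have Dcard: "card (D S) = card (F S)" if "S \<subseteq> {1..m}" for S
    unfolding D_def by (intro card_compress sub' that)
  have Ddown: "t \<in> D S" if "S \<subseteq> {1..m}" "s \<in> D S" "t \<subseteq> s" for S s t
    using compress_downward_closed[OF sub'[OF that(1)]] that(2,3) unfolding D_def by blast
  \<comment> \<open>Restriction to \<open>T\<close> keeps \<open>s\<close> in the compression of the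
    trace of \<open>F S\<close>; since that trace lies in \<open>F T\<close>, monotonicity carries
    \<open>s\<close> on to \<open>D T\<close>.\<close>
  have Dtrace: "s \<in> D T" if "S \<subseteq> {1..m}" "s \<in> D S" "s \<subseteq> T" "T \<subseteq> S" for S T s
    using compress_trace[of s m "F S" T] compress_mono[OF trace[OF that(1,4)], of m] that(2,3)
    unfolding D_def by blast
  have D3: "T \<notin> D T" "\<And>e f. e \<in> [T]\<^bsup>2\<^esup> \<Longrightarrow> f \<in> [T]\<^bsup>2\<^esup> \<Longrightarrow> e \<in> D T \<Longrightarrow> f \<in> D T \<Longrightarrow> e = f"
    if "T \<in> [{1..m}]\<^bsup>3\<^esup>" for T
  proof -
    have T: "T \<subseteq> {1..m}" "finite T" "card T = 3" using that by (auto simp: nsets_def)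
    have five': "card (D T) \<le> 5" using five[OF that] Dcard[OF T(1)] by simp
    have down: "\<forall>s\<in>D T. Pow s \<subseteq> D T" using Ddown[OF T(1)] by blast
    note triple = downward_closed_triple[OF down Dfin[OF T(1)] five' T(2,3)]
    show "T \<notin> D T" by (rule triple(1))
    show "e = f" if "e \<in> [T]\<^bsup>2\<^esup>" "f \<in> [T]\<^bsup>2\<^esup>" "e \<in> D T" "f \<in> D T" for e f
      using that by (rule triple(2))
  qed
  \<comment> \<open>The pair in \<open>D T\<close> is unique if it exists; a triple without one may
    take any of its pairs.\<close>
  have "\<exists>p. p \<in> [T]\<^bsup>2\<^esup> \<and> (\<forall>e \<in> [T]\<^bsup>2\<^esup> \<inter> D T. p = e)" if T: "T \<in> [{1..m}]\<^bsup>3\<^esup>" for T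
  proof (cases "[T]\<^bsup>2\<^esup> \<inter> D T = {}")
    case True
    have "card T = 3" using T by (simp add: nsets_def)
    then have "[T]\<^bsup>2\<^esup> \<noteq> {}" by (simp add: nsets_eq_empty_iff)
    with True show ?thesis by blast
  next
    case False
    with D3(2)[OF T] show ?thesis by blast
  qed
  then obtain g where g: "\<And>T. T \<in> [{1..m}]\<^bsup>3\<^esup> \<Longrightarrow> g T \<in> [T]\<^bsup>2\<^esup>"
      "\<And>T e. T \<in> [{1..m}]\<^bsup>3\<^esup> \<Longrightarrow> e \<in> [T]\<^bsup>2\<^esup> \<Longrightarrow> e \<in> D T \<Longrightarrow> g T = e"
    by (metis IntI)
  have "card (F S) \<le> 1 + card S + card {e \<in> [S]\<^bsup>2\<^esup>. \<forall>z\<in>S - e. g (insert z e) = e}"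
    (is "_ \<le> _ + card ?E") if S: "S \<subseteq> {1..m}" for S
  proof -
    have finS: "finite S" using S finite_subset by blast
    have "s \<in> {{}} \<union> (\<lambda>x. {x}) ` S \<union> ?E" if s: "s \<in> D S" for s
    proof -
      have sS: "s \<subseteq> S" using Dsub[OF S] s by blast
      then have fins: "finite s" using finS finite_subset by blast
      \<comment> \<open>A larger set would contain a triple \<open>T\<close>, which downward closure
        and passage to the trace would put into \<open>D T\<close>.\<close>
      have "card s \<le> 2"
      proof (rule ccontr)
        assume "\<not> card s \<le> 2"
        then have "3 \<le> card s" by simp
        then obtain T where T: "T \<subseteq> s" "card T = 3" "finite T" by (rule obtain_subset_with_card_n)
        then have "T \<in> [{1..m}]\<^bsup>3\<^esup>" using sS S by (auto simp: nsets_def)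
        moreover have "T \<in> D T" using Dtrace[OF S Ddown[OF S s T(1)]] T sS by blast
        ultimately show False using D3(1) by blast
      qed
      then consider "card s = 0" | "card s = 1" | "card s = 2" by linarith
      then show ?thesis
      proof cases
        case 1
        then show ?thesis using fins by simp
      next
        case 2
        then show ?thesis using sS by (auto simp: card_1_singleton_iff)
      next
        case 3
        \<comment> \<open>The triple \<open>insert z s\<close> lies inside \<open>S\<close>, so
          \<open>s\<close> survives in its compression and is the pair that it chooses.\<close>
        have "g (insert z s) = s" if z: "z \<in> S - s" for z
        proof -
          have "insert z s \<in> [{1..m}]\<^bsup>3\<^esup>" using z sS S fins 3 by (auto simp: nsets_def)
          moreover have "s \<in> [insert z s]\<^bsup>2\<^esup>" using fins 3 by (auto simp: nsets_def)
          moreover have "s \<in> D (insert z s)" using Dtrace[OF S s] z sS by blast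
          ultimately show ?thesis by (rule g(2))
        qed
        then show ?thesis using 3 sS fins by (auto simp: nsets_def)
      qed
    qed
    then have "D S \<subseteq> {{}} \<union> (\<lambda>x. {x}) ` S \<union> ?E" by blast
    moreover have "finite ?E" using finS by (simp add: finite_imp_finite_nsets)
    ultimately have "card (D S) \<le> card ({{}} \<union> (\<lambda>x. {x}) ` S \<union> ?E)"
      using finS by (intro card_mono) auto
    also have "\<dots> \<le> card {{} :: nat set} + card ((\<lambda>x. {x}) ` S) + card ?E"
      by (meson add_le_mono card_Un_le le_refl order_trans)
    also have "\<dots> = 1 + card S + card ?E" by (simp add: card_image)
    finally show ?thesis using Dcard[OF S] by simp
  qed
  with g(1) that show thesis by blast
qed

section \<open>Allowed zero-one columns, encoded by their sets of ones\<close>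

definition indicator_vec :: "nat set \<Rightarrow> nat set \<Rightarrow> (nat \<Rightarrow> nat)" where
  "indicator_vec T A = (\<lambda>y\<in>T. if y \<in> A then 1 else 0)"

text \<open>The family called \<open>F S\<close> in the overview above.\<close>

definition avoiding_sets :: "(nat set \<Rightarrow> (nat \<Rightarrow> nat) set) \<Rightarrow> nat set \<Rightarrow> nat set set" where
  "avoiding_sets B S = {A \<in> Pow S. \<forall>T \<in> [S]\<^bsup>3\<^esup>. indicator_vec T A \<notin> B T}"

text \<open>An indicator vector on a triple inside \<open>T\<close> sees only the part of the set
  within \<open>T\<close>, and triples of \<open>T\<close> are triples of \<open>S\<close>.\<close>

lemma avoiding_sets_trace:
  assumes "T \<subseteq> S"
  shows "(\<lambda>A. A \<inter> T) ` avoiding_sets B S \<subseteq> avoiding_sets B T"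
proof -
  have "indicator_vec U (A \<inter> T) = indicator_vec U A" if "U \<in> [T]\<^bsup>3\<^esup>" for U A
    using that unfolding indicator_vec_def nsets_def by (intro restrict_ext) auto
  then have "A \<inter> T \<in> avoiding_sets B T" if "A \<in> avoiding_sets B S" for A
    using that nsets_mono[OF assms, of 3] unfolding avoiding_sets_def by fastforce
  then show ?thesis by blast
qed

lemma unit_vec_on_eq: "unit_vec_on T x = indicator_vec T {x}"
  by (simp add: unit_vec_on_def indicator_vec_def)

lemma counit_vec_on_eq: "counit_vec_on T x = indicator_vec T (T - {x})"
  unfolding counit_vec_on_def unit_vec_on_def indicator_vec_def by (intro restrict_ext) simp

text \<open>From each complementary pair \<open>{x}\<close>, \<open>T - {x}\<close> one set is
  excluded by \<open>B T\<close>. As \<open>|T| = 3\<close>, a singleton is never the complement of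
  a singleton, so three distinct sets are excluded and at most 8 - 3 remain; fewer if
  \<open>B T\<close> contains constant vectors.\<close>

lemma card_avoiding_sets_triple:
  assumes "is_choice m B" and T: "T \<in> [{1..m}]\<^bsup>3\<^esup>"
  shows "card (avoiding_sets B T) \<le> 5"
proof -
  have T': "finite T" "card T = 3" using T by (auto simp: nsets_def)
  have "\<exists>A \<in> {{x}, T - {x}}. indicator_vec T A \<in> B T" if "x \<in> T" for x
  proof -
    have "\<exists>!v. v \<in> {unit_vec_on T x, counit_vec_on T x} \<and> v \<in> B T"
      using assms(1)[unfolded is_choice_def, rule_format, OF T] that by blast
    then have "\<exists>v. v \<in> {unit_vec_on T x, counit_vec_on T x} \<and> v \<in> B T"
      by (rule ex1_implies_ex)
    then show ?thesis by (auto simp: unit_vec_on_eq counit_vec_on_eq)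
  qed
  then obtain a where a: "\<And>x. x \<in> T \<Longrightarrow> a x \<in> {{x}, T - {x}}" "\<And>x. x \<in> T \<Longrightarrow> indicator_vec T (a x) \<in> B T"
    by metis
  have ne: "{x} \<noteq> T - {y}" if "y \<in> T" for x y
  proof
    assume "{x} = T - {y}"
    then have "card {x} = card (T - {y})" by simp
    with T' that show False by simp
  qed
  have inj: "inj_on a T"
  proof (rule inj_onI)
    fix x y assume xy: "x \<in> T" "y \<in> T" "a x = a y"
    with a(1)[of x] a(1)[of y] ne[of x y] ne[of y x]
    have "{x} = {y} \<or> T - {x} = T - {y}" by auto
    with xy show "x = y" by blast
  qed
  have aT: "a ` T \<subseteq> Pow T" using a(1) by fastforce
  have "T \<in> [T]\<^bsup>3\<^esup>" using T' by (simp add: nsets_def)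
  then have "avoiding_sets B T \<subseteq> Pow T - a ` T"
    using a(2) by (auto simp: avoiding_sets_def)
  then have "card (avoiding_sets B T) \<le> card (Pow T - a ` T)"
    using T' by (intro card_mono) auto
  also have "\<dots> = card (Pow T) - card (a ` T)" using aT T' by (intro card_Diff_subset) auto
  also have "\<dots> = 5" using T' inj by (simp add: card_Pow card_image)
  finally show ?thesis .
qed

section \<open>Counting columns by the rows with entries below two\<close>

text \<open>With \<open>S\<close> the set of these rows, a column is determined by its set of ones
  in \<open>S\<close> and its restriction to the other \<open>m - |S|\<close> rows, whose entries
  lie in \<open>{2..<r}\<close>.\<close>

lemma card_avoiding_columns_le:
  "card {c \<in> {1..m} \<rightarrow>\<^sub>E {0..<r}. \<forall>T \<in> [{1..m}]\<^bsup>3\<^esup>. restrict c T \<notin> B T}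
    \<le> (\<Sum>S\<in>Pow {1..m}. card (avoiding_sets B S) * (r - 2) ^ (m - card S))"
proof -
  let ?C = "{c \<in> {1..m} \<rightarrow>\<^sub>E {0..<r}. \<forall>T \<in> [{1..m}]\<^bsup>3\<^esup>. restrict c T \<notin> B T}"
  define C where "C = (\<lambda>S. {c \<in> ?C. {i \<in> {1..m}. c i < 2} = S})"
  have "?C = (\<Union>S\<in>Pow {1..m}. C S)" by (auto simp: C_def)
  then have "card ?C \<le> (\<Sum>S\<in>Pow {1..m}. card (C S))" by (simp add: card_UN_le)
  also have "\<dots> \<le> (\<Sum>S\<in>Pow {1..m}. card (avoiding_sets B S) * (r - 2) ^ (m - card S))"
  proof (rule sum_mono)
    fix S assume "S \<in> Pow {1..m}"
    then have S: "S \<subseteq> {1..m}" by simp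
    then have finS: "finite S" by (rule finite_subset) simp
    define h where "h = (\<lambda>c :: nat \<Rightarrow> nat. ({i \<in> S. c i = 1}, restrict c ({1..m} - S)))"
    let ?R = "avoiding_sets B S \<times> (({1..m} - S) \<rightarrow>\<^sub>E {2..<r})"
    have CS: "i \<in> S \<longleftrightarrow> c i < 2" if "c \<in> C S" "i \<in> {1..m}" for c i
      using that unfolding C_def by blast
    have "finite ?R"
      using finS by (intro finite_cartesian_product finite_PiE) (auto simp: avoiding_sets_def)
    moreover have "inj_on h (C S)"
    proof (rule inj_onI, rule ext)
      fix c d i assume c: "c \<in> C S" and d: "d \<in> C S" and eq: "h c = h d"
      have ext: "c \<in> extensional {1..m}" "d \<in> extensional {1..m}"
        using c d unfolding C_def PiE_def by blast+
      consider "i \<notin> {1..m}" | "i \<in> S" | "i \<in> {1..m} - S" by blast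
      then show "c i = d i"
      proof cases
        case 1
        then show ?thesis using ext[THEN extensional_arb] by metis
      next
        case 2
        then have "c i < 2" "d i < 2" using S CS c d by blast+
        moreover have "c i = 1 \<longleftrightarrow> d i = 1" using 2 eq by (auto simp: h_def)
        ultimately show ?thesis by linarith
      next
        case 3
        have "restrict c ({1..m} - S) i = restrict d ({1..m} - S) i" using eq by (simp add: h_def)
        then show ?thesis using 3 by (simp only: restrict_apply' 3 if_True)
      qed
    qed
    moreover have "h ` C S \<subseteq> ?R"
    proof (rule image_subsetI)
      fix c assume c: "c \<in> C S"
      \<comment> \<open>Rows of \<open>S\<close> carry only 0 and 1, so the set of ones recovers the
        column on every triple inside \<open>S\<close>.\<close>
      have "indicator_vec T {i \<in> S. c i = 1} = restrict c T" if "T \<in> [S]\<^bsup>3\<^esup>" for T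
      proof -
        have "(if y \<in> {i \<in> S. c i = 1} then 1 else 0) = c y" if "y \<in> T" for y
        proof -
          have "y \<in> S" using that \<open>T \<in> [S]\<^bsup>3\<^esup>\<close> by (auto simp: nsets_def)
          with CS[OF c, of y] S have "c y < 2" by blast
          with \<open>y \<in> S\<close> show ?thesis by auto
        qed
        then show ?thesis unfolding indicator_vec_def by (intro restrict_ext) blast
      qed
      moreover have "restrict c T \<notin> B T" if "T \<in> [S]\<^bsup>3\<^esup>" for T
        using that c nsets_mono[OF S, of 3] unfolding C_def by blast
      ultimately have "{i \<in> S. c i = 1} \<in> avoiding_sets B S" by (auto simp: avoiding_sets_def)
      moreover have "c i \<in> {2..<r}" if "i \<in> {1..m} - S" for i
      proof -
        have "c i \<in> {0..<r}" using c that unfolding C_def by blast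
        then show ?thesis using CS[OF c, of i] that by auto
      qed
      ultimately show "h c \<in> ?R" unfolding h_def by auto
    qed
    ultimately have "card (C S) \<le> card ?R" by (intro card_inj_on_le)
    also have "\<dots> = card (avoiding_sets B S) * (r - 2) ^ card ({1..m} - S)"
      by (simp add: card_cartesian_product card_funcsetE)
    also have "card ({1..m} - S) = m - card S" using S finS by (simp add: card_Diff_subset)
    finally show "card (C S) \<le> card (avoiding_sets B S) * (r - 2) ^ (m - card S)" .
  qed
  finally show ?thesis .
qed

lemma forb_le_card_columns:
  "forb m r B \<le> card {c \<in> {1..m} \<rightarrow>\<^sub>E {0..<r}. \<forall>T \<in> [{1..m}]\<^bsup>3\<^esup>. restrict c T \<notin> B T}"
  (is "_ \<le> card ?C")
proof -
  have "forb m r B \<in> {n. \<exists>A. simple_matrix m n r A \<and> avoids m n B A}"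
    unfolding forb_def using forb_set_nonempty by (intro Max_in finite_forb_set) blast
  then obtain A where A: "simple_matrix m (forb m r B) r A" "avoids m (forb m r B) B A" by blast
  have "finite ?C" by (rule finite_subset[of _ "{1..m} \<rightarrow>\<^sub>E {0..<r}"]) (auto intro: finite_PiE)
  moreover have "A ` {1..forb m r B} \<subseteq> ?C" "inj_on A {1..forb m r B}"
    using A unfolding simple_matrix_def avoids_def by blast+
  ultimately have "card {1..forb m r B} \<le> card ?C" by (intro card_inj_on_le)
  then show ?thesis by simp
qed

section \<open>Weighted sums over intervals of sets, and edge multiplicities\<close>

text \<open>Put \<open>S = P \<union> X\<close> with \<open>X \<subseteq> Z\<close>. Then
  \<open>n - |S|\<close> is \<open>n - |P| - |Z|\<close> plus \<open>|Z - X|\<close>, where the size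
  assumption keeps truncated subtraction exact, and the binomial theorem sums the powers. The cases
  of \<open>P\<close> empty, a singleton and a pair give the three terms of the bound.\<close>

lemma sum_power_between:
  fixes a :: "'a::comm_semiring_1"
  assumes "finite P" "finite Z" "P \<inter> Z = {}" "card P + card Z \<le> n"
  shows "(\<Sum>S | P \<subseteq> S \<and> S \<subseteq> P \<union> Z. a ^ (n - card S)) = a ^ (n - card P - card Z) * (a + 1) ^ card Z"
proof -
  have "(\<Sum>S | P \<subseteq> S \<and> S \<subseteq> P \<union> Z. a ^ (n - card S)) = (\<Sum>X\<in>Pow Z. a ^ (n - card (P \<union> X)))"
    using assms(3) by (intro sum.reindex_bij_witness[of _ "\<lambda>X. P \<union> X" "\<lambda>S. S - P"]) (auto simp: Un_absorb1)
  also have "\<dots> = (\<Sum>X\<in>Pow Z. a ^ (n - card P - card Z) * a ^ card (Z - X))"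
  proof (rule sum.cong)
    fix X assume "X \<in> Pow Z"
    then have X: "X \<subseteq> Z" "finite X" using assms(2) finite_subset by auto
    then have "card (P \<union> X) = card P + card X" "card (Z - X) = card Z - card X" "card X \<le> card Z"
      using assms by (auto intro!: card_Un_disjoint card_Diff_subset card_mono)
    then have "n - card (P \<union> X) = (n - card P - card Z) + card (Z - X)" using assms(4) by linarith
    then show "a ^ (n - card (P \<union> X)) = a ^ (n - card P - card Z) * a ^ card (Z - X)"
      by (simp only: power_add)
  qed simp
  also have "\<dots> = a ^ (n - card P - card Z) * (\<Sum>X\<in>Pow Z. a ^ card (Z - X))"
    by (simp add: sum_distrib_left)
  also have "(\<Sum>X\<in>Pow Z. a ^ card (Z - X)) = (a + 1) ^ card Z"
    using prod_add[OF assms(2), of "\<lambda>_. 1" "\<lambda>_. a"] by (simp add: add.commute)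
  finally show ?thesis .
qed

text \<open>A triple that chooses \<open>e\<close> contains \<open>e\<close>, so it arises from
  \<open>e\<close> by adding exactly one vertex \<open>z\<close>, and different \<open>z\<close>
  give different triples.\<close>

lemma count_tcm:
  fixes m :: nat
  assumes g: "\<And>T. T \<in> [{1..m}]\<^bsup>3\<^esup> \<Longrightarrow> g T \<in> [T]\<^bsup>2\<^esup>" and e: "e \<in> [{1..m}]\<^bsup>2\<^esup>"
  shows "count (image_mset g (mset_set ([{1..m}]\<^bsup>3\<^esup>))) e = card {z \<in> {1..m} - e. g (insert z e) = e}"
proof -
  have fin: "finite ([{1..m}]\<^bsup>3\<^esup>)" by (simp add: finite_imp_finite_nsets)
  have e': "e \<subseteq> {1..m}" "finite e" "card e = 2" using e by (auto simp: nsets_def)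
  have "count (image_mset g (mset_set ([{1..m}]\<^bsup>3\<^esup>))) e = card {T \<in> [{1..m}]\<^bsup>3\<^esup>. e = g T}"
    using fin by (simp add: count_image_mset')
  also have "{T \<in> [{1..m}]\<^bsup>3\<^esup>. e = g T} = (\<lambda>z. insert z e) ` {z \<in> {1..m} - e. g (insert z e) = e}"
    (is "?L = ?R")
  proof (intro equalityI subsetI)
    fix T assume T: "T \<in> ?L"
    then have eT: "e \<subseteq> T" using g[of T] by (auto simp: nsets_def)
    have T': "T \<subseteq> {1..m}" "finite T" "card T = 3" using T by (auto simp: nsets_def)
    then have "card (T - e) = 1" using eT e' by (simp add: card_Diff_subset)
    then obtain z where z: "T - e = {z}" by (auto simp: card_1_singleton_iff)
    then have "T = insert z e" "z \<in> {1..m} - e" using eT T' by blast+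
    then show "T \<in> ?R" using T by blast
  next
    fix T assume "T \<in> ?R"
    then show "T \<in> ?L" using e' by (auto simp: nsets_def)
  qed
  also have "card \<dots> = card {z \<in> {1..m} - e. g (insert z e) = e}"
    by (intro card_image inj_onI) blast
  finally show ?thesis .
qed

section \<open>Summation over all row sets\<close>

theorem theorem3p4:
  fixes m r :: nat and B :: "nat set \<Rightarrow> (nat \<Rightarrow> nat) set"
  assumes "r \<ge> 3" and "bad_choice m B"
  shows "real (forb m r B) - (real r - 1) ^ m - real m * (real r - 1) powi (int m - 1)
         \<le> max_tcm_weight m ((real r - 1) / (real r - 2)) * (real r - 2) powi (int m - 2)"
proof -
  define a where "a = real r - 2"
  have a: "a > 0" "real r - 1 = a + 1" "real (r - 2) = a" using assms(1) by (simp_all add: a_def)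
  have B: "is_choice m B" "[{1..m}]\<^bsup>3\<^esup> \<noteq> {}" using assms(2) by (auto simp: bad_choice_def)
  \<comment> \<open>The triple of type \<open>I\<close> or \<open>I^c\<close> forces
    \<open>m \<ge> 3\<close>, so the natural differences \<open>m - 1\<close> and
    \<open>m - 2\<close> agree with the integer exponents.\<close>
  then have m: "m \<ge> 3" by (auto simp: nsets_eq_empty_iff not_less)
  let ?U = "{1..m}"
  obtain g where g: "\<And>T. T \<in> [?U]\<^bsup>3\<^esup> \<Longrightarrow> g T \<in> [T]\<^bsup>2\<^esup>"
    and card_le: "\<And>S. S \<subseteq> ?U \<Longrightarrow>
      card (avoiding_sets B S) \<le> 1 + card S + card {e \<in> [S]\<^bsup>2\<^esup>. \<forall>z\<in>S - e. g (insert z e) = e}"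
  proof (rule obtain_tcm_choice[of m "avoiding_sets B"])
    show "avoiding_sets B S \<subseteq> Pow S" for S by (auto simp: avoiding_sets_def)
  qed (use avoiding_sets_trace card_avoiding_sets_triple[OF B(1)] in auto)
  define G where "G = image_mset g (mset_set ([?U]\<^bsup>3\<^esup>))"
  define Z where "Z = (\<lambda>e. {z \<in> ?U - e. g (insert z e) = e})"
  have count: "count G e = card (Z e)" if "e \<in> [?U]\<^bsup>2\<^esup>" for e
    unfolding G_def Z_def using g that by (rule count_tcm)
  have finP: "finite (Pow ?U)" and fin2: "finite ([?U]\<^bsup>2\<^esup>)" by (simp_all add: finite_imp_finite_nsets)

  have empty: "(\<Sum>S\<in>Pow ?U. a ^ (m - card S)) = (a + 1) ^ m"
    using sum_power_between[of "{}" ?U m a] by (simp add: Pow_def)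
  \<comment> \<open>Double counting of the pairs \<open>(i, S)\<close> with
    \<open>i \<in> S\<close>: for fixed \<open>i\<close>, the set \<open>S\<close> runs through the
    interval from \<open>{i}\<close> to all rows.\<close>
  have single: "(\<Sum>S\<in>Pow ?U. real (card S) * a ^ (m - card S)) = m * (a + 1) ^ (m - 1)"
  proof -
    have "(\<Sum>S\<in>Pow ?U. real (card S) * a ^ (m - card S)) = (\<Sum>S\<in>Pow ?U. \<Sum>i | i \<in> ?U \<and> i \<in> S. a ^ (m - card S))"
    proof (rule sum.cong)
      fix S assume "S \<in> Pow ?U"
      then have "{i. i \<in> ?U \<and> i \<in> S} = S" by blast
      then show "real (card S) * a ^ (m - card S) = (\<Sum>i | i \<in> ?U \<and> i \<in> S. a ^ (m - card S))" by simp
    qed simp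
    also have "\<dots> = (\<Sum>i\<in>?U. \<Sum>S | S \<in> Pow ?U \<and> i \<in> S. a ^ (m - card S))"
      by (rule sum.swap_restrict) auto
    also have "\<dots> = (\<Sum>i\<in>?U. (a + 1) ^ (m - 1))"
    proof (rule sum.cong)
      fix i assume i: "i \<in> ?U"
      then have "{S. S \<in> Pow ?U \<and> i \<in> S} = {S. {i} \<subseteq> S \<and> S \<subseteq> {i} \<union> (?U - {i})}" by blast
      then show "(\<Sum>S | S \<in> Pow ?U \<and> i \<in> S. a ^ (m - card S)) = (a + 1) ^ (m - 1)"
        using sum_power_between[of "{i}" "?U - {i}" m a] i m by simp
    qed simp
    finally show ?thesis by simp
  qed
  \<comment> \<open>A pair \<open>e \<subseteq> S\<close> is counted in \<open>p(S)\<close> exactly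
    if all further elements of \<open>S\<close> lie in \<open>Z e\<close>. Hence for fixed
    \<open>e\<close> the sets \<open>S\<close> form an interval.\<close>
  let ?R = "\<lambda>S e. e \<subseteq> S \<and> S \<subseteq> e \<union> Z e"
  have pair: "(\<Sum>S\<in>Pow ?U. real (card {e \<in> [?U]\<^bsup>2\<^esup>. ?R S e}) * a ^ (m - card S))
      = tcm_weight m G ((a + 1) / a) * a ^ (m - 2)"
  proof -
    have "(\<Sum>S\<in>Pow ?U. real (card {e \<in> [?U]\<^bsup>2\<^esup>. ?R S e}) * a ^ (m - card S))
        = (\<Sum>S\<in>Pow ?U. \<Sum>e | e \<in> [?U]\<^bsup>2\<^esup> \<and> ?R S e. a ^ (m - card S))" by simp
    also have "\<dots> = (\<Sum>e\<in>[?U]\<^bsup>2\<^esup>. \<Sum>S | S \<in> Pow ?U \<and> ?R S e. a ^ (m - card S))"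
      by (rule sum.swap_restrict[OF finP fin2])
    also have "\<dots> = (\<Sum>e\<in>[?U]\<^bsup>2\<^esup>. ((a + 1) / a) ^ count G e * a ^ (m - 2))"
    proof (rule sum.cong)
      fix e assume e: "e \<in> [?U]\<^bsup>2\<^esup>"
      then have e': "e \<subseteq> ?U" "finite e" "card e = 2" by (auto simp: nsets_def)
      have "card (Z e) \<le> card (?U - e)" unfolding Z_def by (intro card_mono) auto
      also have "\<dots> = m - 2" using e' by (simp add: card_Diff_subset)
      finally have k: "card (Z e) \<le> m - 2" .
      have "{S. S \<in> Pow ?U \<and> ?R S e} = {S. ?R S e}" using e' by (auto simp: Z_def)
      then have "(\<Sum>S | S \<in> Pow ?U \<and> ?R S e. a ^ (m - card S)) = (\<Sum>S | ?R S e. a ^ (m - card S))"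
        by simp
      also have "\<dots> = a ^ (m - card e - card (Z e)) * (a + 1) ^ card (Z e)"
        using e' k m by (intro sum_power_between) (auto simp: Z_def)
      \<comment> \<open>Each vertex of \<open>Z e\<close> contributes \<open>a + 1\<close> in place
        of \<open>a\<close>; extracting \<open>a ^ (m - 2)\<close> therefore leaves powers of
        \<open>(a + 1) / a\<close>, the base in the weight of the TCM.\<close>
      also have "\<dots> = ((a + 1) / a) ^ card (Z e) * a ^ (m - 2)"
      proof -
        have "m - 2 = (m - card e - card (Z e)) + card (Z e)" using k e'(3) by simp
        then have "a ^ (m - 2) = a ^ (m - card e - card (Z e)) * a ^ card (Z e)"
          by (metis power_add)
        then show ?thesis using a(1) by (simp add: power_divide)
      qed
      finally show "(\<Sum>S | S \<in> Pow ?U \<and> ?R S e. a ^ (m - card S)) = ((a + 1) / a) ^ count G e * a ^ (m - 2)"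
        by (simp add: count[OF e])
    qed simp
    finally show ?thesis by (simp add: tcm_weight_def sum_distrib_right)
  qed

  have "real (forb m r B) \<le> real (\<Sum>S\<in>Pow ?U. card (avoiding_sets B S) * (r - 2) ^ (m - card S))"
    using forb_le_card_columns[of m r B] card_avoiding_columns_le[of m r B] by linarith
  also have "\<dots> = (\<Sum>S\<in>Pow ?U. real (card (avoiding_sets B S)) * a ^ (m - card S))"
    by (simp only: of_nat_sum of_nat_mult of_nat_power a(3))
  also have "\<dots> \<le> (\<Sum>S\<in>Pow ?U. (1 + real (card S) + real (card {e \<in> [?U]\<^bsup>2\<^esup>. ?R S e})) * a ^ (m - card S))"
  proof (rule sum_mono)
    fix S assume "S \<in> Pow ?U"
    then have S: "S \<subseteq> ?U" by simp
    have "{e \<in> [S]\<^bsup>2\<^esup>. \<forall>z\<in>S - e. g (insert z e) = e} \<subseteq> {e \<in> [?U]\<^bsup>2\<^esup>. ?R S e}"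
      using S by (auto simp: nsets_def Z_def)
    then have "card {e \<in> [S]\<^bsup>2\<^esup>. \<forall>z\<in>S - e. g (insert z e) = e} \<le> card {e \<in> [?U]\<^bsup>2\<^esup>. ?R S e}"
      using fin2 by (intro card_mono) auto
    then have "card (avoiding_sets B S) \<le> 1 + card S + card {e \<in> [?U]\<^bsup>2\<^esup>. ?R S e}"
      using card_le[OF S] by linarith
    then have "real (card (avoiding_sets B S)) \<le> 1 + real (card S) + real (card {e \<in> [?U]\<^bsup>2\<^esup>. ?R S e})"
      by linarith
    then show "real (card (avoiding_sets B S)) * a ^ (m - card S)
        \<le> (1 + real (card S) + real (card {e \<in> [?U]\<^bsup>2\<^esup>. ?R S e})) * a ^ (m - card S)"
      using a(1) by (intro mult_right_mono) auto
  qed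
  also have "\<dots> = (a + 1) ^ m + m * (a + 1) ^ (m - 1) + tcm_weight m G ((a + 1) / a) * a ^ (m - 2)"
    by (simp only: distrib_right sum.distrib mult_1 empty single pair)
  also have "tcm_weight m G ((a + 1) / a) \<le> max_tcm_weight m ((a + 1) / a)"
  proof -
    have "is_tcm m G" unfolding is_tcm_def G_def using g by blast
    then show ?thesis unfolding max_tcm_weight_def by (intro Max_ge finite_tcm_weights) blast
  qed
  finally have main: "real (forb m r B) \<le>
      (a + 1) ^ m + m * (a + 1) ^ (m - 1) + max_tcm_weight m ((a + 1) / a) * a ^ (m - 2)"
    using a(1) by (simp add: mult_right_mono)
  have "int m - 1 = int (m - 1)" "int m - 2 = int (m - 2)" using m by simp_all
  then show ?thesis using main a(2) by (simp only: power_int_of_nat flip: a_def)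
qed

end
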